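(* Let $e=(1,0,\dots,0)\in\mathbb{R}^{n+1}$ and let $F\in\mathbb{R}[x_0,\dots,x_n]$ be a form of degree $d$ with $F(e)=1$. Write $\mathbf{x}=(x_1,\dots,x_n)$, $f_{\mathbf{x}}(t)=F(t,\mathbf{x})$, and let $f_{\mathrm{Re}},f_{\mathrm{Im}}\in\mathbb{R}[t_1,t_2,\mathbf{x}]$ be the polynomials determined by $f_{\mathbf{x}}(t_1+it_2)=f_{\mathrm{Re}}(t_1,t_2,\mathbf{x})+i\,f_{\mathrm{Im}}(t_1,t_2,\mathbf{x})$. Then the resultant of $f_{\mathrm{Re}}$ and $f_{\mathrm{Im}}$ with respect to $t_1$ factors as $$\mathrm{Res}_{t_1}(f_{\mathrm{Re}},f_{\mathrm{Im}})=t_2^{p}\cdot\mathcal{R}_F$$ for some $p\ge d$, where $\mathcal{R}_F\in\mathbb{R}[t_2,x_1,\dots,x_n]$ is a polynomial not divisible by $t_2$. Moreover: (1) If $F$ is hyperbolic with respect to $e$, then $\mathcal{R}_F$ has constant sign on $\mathbb{R}\times\mathbb{R}^n$, i.e. it is everywhere nonnegative or everywhere nonpositive. (2) Conversely, if $\mathcal{R}_F(t_2,x_1,\dots,x_n)$ does not vanish at any point $(s,a)\in\mathbb{R}\times\mathbb{R}^n$ with $s\neq 0$, then $F$ is hyperbolic with respect to $e$.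
   Context: A form is a homogeneous polynomial. A univariate real polynomial is real rooted if all its complex roots are real. A form $F\in\mathbb{R}[x_0,\dots,x_n]$ is hyperbolic with respect to $e\in\mathbb{R}^{n+1}$ if $F(e)\ne 0$ and $F(te-a)\in\mathbb{R}[t]$ is real rooted for all $a\in\mathbb{R}^{n+1}$. As polynomials in $t_1$, $f_{\mathrm{Re}}$ has degree $d$ and $f_{\mathrm{Im}}$ has degree $d-1$ (with leading coefficient $d\,t_2$); $\mathrm{Res}_{t_1}(f_{\mathrm{Re}},f_{\mathrm{Im}})\in\mathbb{R}[t_2,\mathbf{x}]$ is the determinant of the corresponding $(2d-1)\times(2d-1)$ Sylvester matrix. *)

theory Defs
  imports
    Complex_Main
    "HOL-Library.Poly_Mapping"
    "HOL-Computational_Algebra.Polynomial"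
    "Subresultants.Resultant_Prelim"
begin

text \<open>
  Polynomials in the variables \<open>x\<^sub>0, x\<^sub>1, x\<^sub>2, \<dots>\<close>; the ring in the variables
  \<open>x\<^sub>0, \<dots>, x\<^sub>n\<close> consists of those \<open>F\<close> with \<open>indets F \<subseteq> {..n}\<close>.
\<close>

type_synonym 'a mpoly = "(nat \<Rightarrow>\<^sub>0 nat) \<Rightarrow>\<^sub>0 'a"

definition indets :: "'a::zero mpoly \<Rightarrow> nat set" where
  "indets F = (\<Union>m\<in>Poly_Mapping.keys F. Poly_Mapping.keys m)"

definition Const :: "'a::zero \<Rightarrow> 'a mpoly" where
  "Const c = Poly_Mapping.single 0 c"

definition Var :: "nat \<Rightarrow> 'a::zero_neq_one mpoly" where
  "Var i = Poly_Mapping.single (Poly_Mapping.single i 1) 1"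

text \<open>
  Substitution of \<open>x i\<close> for the variable \<open>x\<^sub>i\<close>, with coefficients mapped by \<open>h\<close>
  (intended to be a ring homomorphism).
\<close>

definition msubst :: "('a::zero \<Rightarrow> 'b::comm_semiring_1) \<Rightarrow> (nat \<Rightarrow> 'b) \<Rightarrow> 'a mpoly \<Rightarrow> 'b" where
  "msubst h x F = (\<Sum>m\<in>Poly_Mapping.keys F. h (Poly_Mapping.lookup F m) *
     (\<Prod>i\<in>Poly_Mapping.keys m. x i ^ Poly_Mapping.lookup m i))"

definition meval :: "real mpoly \<Rightarrow> (nat \<Rightarrow> real) \<Rightarrow> real" where
  "meval F x = msubst (\<lambda>c. c) x F"

definition is_form :: "nat \<Rightarrow> 'a::zero mpoly \<Rightarrow> bool" where
  "is_form d F \<longleftrightarrow>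
     (\<forall>m\<in>Poly_Mapping.keys F. (\<Sum>i\<in>Poly_Mapping.keys m. Poly_Mapping.lookup m i) = d)"

definition real_rooted :: "real poly \<Rightarrow> bool" where
  "real_rooted p \<longleftrightarrow> (\<forall>z::complex. poly (map_poly complex_of_real p) z = 0 \<longrightarrow> z \<in> \<real>)"

text \<open>
  Points of \<open>n+1\<close>-dimensional real space are given by functions on \<^typ>\<open>nat\<close>, of which only
  the coordinates \<open>0, \<dots>, n\<close> matter for polynomials with \<open>indets F \<subseteq> {..n}\<close>.
  The polynomial \<open>[:- a i, e i:]\<close> is the \<open>i\<close>-th coordinate of \<open>t e - a\<close>.
\<close>

definition hyperbolic :: "real mpoly \<Rightarrow> (nat \<Rightarrow> real) \<Rightarrow> bool" where
  "hyperbolic F e \<longleftrightarrow> meval F e \<noteq> 0 \<and>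
     (\<forall>a. real_rooted (msubst (\<lambda>c. [:c:]) (\<lambda>i. [:- a i, e i:]) F))"

definition e0 :: "nat \<Rightarrow> real" where
  "e0 = (\<lambda>i. if i = 0 then 1 else 0)"

text \<open>
  A polynomial in \<open>t\<^sub>1, t\<^sub>2, x\<^sub>1, \<dots>, x\<^sub>n\<close> is represented as a univariate polynomial in
  \<open>t\<^sub>1\<close> whose coefficients are polynomials in \<open>t\<^sub>2 = Var 0\<close> and \<open>x\<^sub>i = Var i\<close> for
  \<open>i \<ge> 1\<close>. The next polynomial is \<open>F(t\<^sub>1 + \<i> t\<^sub>2, x\<^sub>1, \<dots>, x\<^sub>n)\<close>.
\<close>

definition cplx_shift :: "real mpoly \<Rightarrow> complex mpoly poly" where
  "cplx_shift F = msubst (\<lambda>c. [:Const (complex_of_real c):])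
     (\<lambda>i. if i = 0 then [:Const \<i> * Var 0, 1:] else [:Var i:]) F"

definition complexify :: "real mpoly poly \<Rightarrow> complex mpoly poly" where
  "complexify = map_poly (Poly_Mapping.map complex_of_real)"

definition re_im_parts :: "real mpoly \<Rightarrow> real mpoly poly \<Rightarrow> real mpoly poly \<Rightarrow> bool" where
  "re_im_parts F fRe fIm \<longleftrightarrow>
     cplx_shift F = complexify fRe + [:Const \<i>:] * complexify fIm"

lemma lookup_coeff_map_poly_map:
  assumes "f 0 = 0"
  shows "Poly_Mapping.lookup (coeff (map_poly (Poly_Mapping.map f) p) k) m =
     f (Poly_Mapping.lookup (coeff p k) m)"
proof -
  have "Poly_Mapping.map f 0 = 0"
    by (rule poly_mapping_eqI) (simp add: Poly_Mapping.map.rep_eq)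
  then show ?thesis
    using assms by (subst coeff_map_poly) (auto simp: Poly_Mapping.map.rep_eq when_def)
qed

lemma lookup_coeff_complexify:
  "Poly_Mapping.lookup (coeff (complexify p) k) m =
     complex_of_real (Poly_Mapping.lookup (coeff p k) m)"
  by (simp add: complexify_def lookup_coeff_map_poly_map)

lemma lookup_coeff_re_im:
  "Poly_Mapping.lookup (coeff (complexify p + [:Const \<i>:] * complexify q) k) m =
     Complex (Poly_Mapping.lookup (coeff p k) m) (Poly_Mapping.lookup (coeff q k) m)"
proof -
  have "Poly_Mapping.lookup (Const c * r) m = c * Poly_Mapping.lookup r m"
    for c :: complex and r :: "complex mpoly"
    unfolding Const_def mult_map_scale_conv_mult[symmetric]
    by (simp add: Poly_Mapping.map.rep_eq when_def)
  then show ?thesis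
    by (simp add: lookup_add lookup_coeff_complexify Complex_eq)
qed

text \<open>The polynomials \<open>f\<^sub>R\<^sub>e\<close> and \<open>f\<^sub>I\<^sub>m\<close> exist and are unique.\<close>

lemma re_im_parts_ex1: "\<exists>!(fRe, fIm). re_im_parts F fRe fIm"
proof -
  define part :: "(complex \<Rightarrow> real) \<Rightarrow> real mpoly poly"
    where "part g = map_poly (Poly_Mapping.map g) (cplx_shift F)" for g
  have part: "Poly_Mapping.lookup (coeff (part g) k) m =
      g (Poly_Mapping.lookup (coeff (cplx_shift F) k) m)" if "g 0 = 0" for g k m
    using that by (simp add: part_def lookup_coeff_map_poly_map)
  have eqI: "p = q" if "\<And>k m. Poly_Mapping.lookup (coeff p k) m = Poly_Mapping.lookup (coeff q k) m"
    for p q :: "'b::zero mpoly poly"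
    using that by (intro poly_eqI poly_mapping_eqI)
  have "re_im_parts F (part Re) (part Im)"
    unfolding re_im_parts_def by (rule eqI) (simp only: lookup_coeff_re_im part complex_surj zero_complex.sel)
  moreover have "p = part Re \<and> q = part Im" if "re_im_parts F p q" for p q
    using that unfolding re_im_parts_def
    by (intro conjI eqI) (simp_all only: part lookup_coeff_re_im complex.sel zero_complex.sel)
  ultimately show ?thesis
    by (intro ex1I[of _ "(part Re, part Im)"]) (blast, fast)
qed

end

(*
  Fix a real point a and let r_1, ..., r_d be the complex roots of f_a. For real s <> 0 the
  polynomials f_Re and f_Im become A and B with A + i B = f_a(t + i s) and A - i B = f_a(t - i s).
  Replacing A by A + i B does not change the resultant with B, so Res(A, B) is the product of the
  values of B at the roots r_j - i s of A + i B. Up to a constant these are the values f_a(r_j - 2 i s),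
  and pairing the factors gives
    Res(A, B) = s^d * prod_{k < j} -(4 s^2 + (r_j - r_k)^2).
  The second factor is an even polynomial in s, which gives p >= d and the parity of p - d. Its
  sign does not depend on a when all roots are real, and it vanishes at s = Im z when z and its
  conjugate are two distinct roots.
*)
theory Submission
  imports
    Defs
    "Subresultants.Subresultant"
    "HOL-Computational_Algebra.Fundamental_Theorem_Algebra"
    "HOL-Computational_Algebra.Field_as_Ring"
begin

section \<open>Substitution homomorphisms\<close>

text \<open>The inner product of \<open>msubst\<close>, split off so that its multiplicativity in
  the monomial can be stated.\<close>

definition monval :: "(nat \<Rightarrow> 'b::comm_semiring_1) \<Rightarrow> (nat \<Rightarrow>\<^sub>0 nat) \<Rightarrow> 'b" where
  "monval x m = (\<Prod>i\<in>Poly_Mapping.keys m. x i ^ Poly_Mapping.lookup m i)"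

lemma monval_superset:
  assumes "finite K" "Poly_Mapping.keys m \<subseteq> K"
  shows "monval x m = (\<Prod>i\<in>K. x i ^ Poly_Mapping.lookup m i)"
  unfolding monval_def by (rule prod.mono_neutral_left) (use assms in \<open>auto simp: in_keys_iff\<close>)

lemma monval_0 [simp]: "monval x 0 = 1"
  by (simp add: monval_def)

lemma monval_add: "monval x (m + m') = monval x m * monval x m'"
proof -
  let ?K = "Poly_Mapping.keys m \<union> Poly_Mapping.keys m'"
  have "finite ?K" "Poly_Mapping.keys (m + m') \<subseteq> ?K" by (auto simp: keys_add)
  then show ?thesis
    by (simp add: monval_superset[of ?K] lookup_add power_add prod.distrib)
qed

lemma monval_single: "monval x (Poly_Mapping.single i k) = x i ^ k"
  by (simp add: monval_def)

text \<open>Monomials outside \<open>keys F\<close> have coefficient 0, which \<open>h\<close>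
  preserves. This allows the sums for several polynomials to run over one common set of
  monomials.\<close>

lemma msubst_superset:
  assumes "h 0 = 0" "finite K" "Poly_Mapping.keys F \<subseteq> K"
  shows "msubst h x F = (\<Sum>m\<in>K. h (Poly_Mapping.lookup F m) * monval x m)"
  unfolding msubst_def monval_def
  by (rule sum.mono_neutral_left) (use assms in \<open>auto simp: in_keys_iff\<close>)

lemma mpoly_eq_sum_single:
  "F = (\<Sum>m\<in>Poly_Mapping.keys F. Poly_Mapping.single m (Poly_Mapping.lookup F m))"
  by (rule poly_mapping_eqI)
    (auto simp: lookup_sum lookup_single when_def in_keys_iff)

lemma msubst_single:
  assumes "h 0 = 0"
  shows "msubst h x (Poly_Mapping.single m c) = h c * monval x m"
  using assms by (subst msubst_superset[where K = "{m}"]) auto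

context comm_ring_hom
begin

lemma msubst_add: "msubst hom x (F + G) = msubst hom x F + msubst hom x G"
proof -
  let ?K = "Poly_Mapping.keys F \<union> Poly_Mapping.keys G"
  have "Poly_Mapping.keys (F + G) \<subseteq> ?K" by (rule keys_add)
  then show ?thesis
    by (simp add: msubst_superset[where K = ?K] lookup_add hom_distribs algebra_simps sum.distrib)
qed

lemma msubst_sum: "msubst hom x (sum F A) = (\<Sum>i\<in>A. msubst hom x (F i))"
  by (induction A rule: infinite_finite_induct) (simp_all add: msubst_add, simp_all add: msubst_def)

text \<open>By additivity, multiplicativity reduces to products of single terms, where it is
  \<open>monval_add\<close>.\<close>

lemma comm_ring_hom_msubst: "comm_ring_hom (msubst hom x)"
proof
  show "msubst hom x 1 = 1"
    using msubst_single[of hom x 0 1] by simp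
  show "msubst hom x (F + G) = msubst hom x F + msubst hom x G" for F G
    by (rule msubst_add)
  show "msubst hom x (F * G) = msubst hom x F * msubst hom x G" for F G
  proof -
    have "F * G = (\<Sum>m\<in>Poly_Mapping.keys F. \<Sum>m'\<in>Poly_Mapping.keys G.
        Poly_Mapping.single (m + m') (Poly_Mapping.lookup F m * Poly_Mapping.lookup G m'))"
      by (subst mpoly_eq_sum_single[of F], subst mpoly_eq_sum_single[of G])
        (simp add: sum_product mult_single)
    then have "msubst hom x (F * G) = (\<Sum>m\<in>Poly_Mapping.keys F. \<Sum>m'\<in>Poly_Mapping.keys G.
        (hom (Poly_Mapping.lookup F m) * monval x m) * (hom (Poly_Mapping.lookup G m') * monval x m'))"
      by (simp add: msubst_sum msubst_single monval_add hom_distribs mult_ac)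
    also have "\<dots> = msubst hom x F * msubst hom x G"
      by (simp add: sum_product[symmetric] msubst_def monval_def)
    finally show ?thesis .
  qed
qed (simp add: msubst_def)

text \<open>Identities between composed substitutions thereby reduce to comparing the images of
  constants and variables.\<close>

lemma hom_msubst: "hom (msubst h x F) = msubst (\<lambda>c. hom (h c)) (\<lambda>i. hom (x i)) F"
  by (simp add: msubst_def hom_distribs)

end

lemma comm_ring_hom_meval: "comm_ring_hom (\<lambda>P. meval P x)"
proof -
  interpret comm_ring_hom "\<lambda>c::real. c" by unfold_locales auto
  show ?thesis unfolding meval_def by (rule comm_ring_hom_msubst)
qed

lemma meval_conv_monval:
  "meval P x = (\<Sum>m\<in>Poly_Mapping.keys P. Poly_Mapping.lookup P m * monval x m)"
  by (simp add: meval_def msubst_def monval_def)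

section \<open>Vanishing and divisibility by a variable\<close>

text \<open>Monomials are distinct characters of the multiplicative monoid of points, so Dedekind's
  argument for the linear independence of characters applies.\<close>

lemma monval_lin_indep:
  fixes c :: "(nat \<Rightarrow>\<^sub>0 nat) \<Rightarrow> real"
  assumes "finite K" "\<And>x. (\<Sum>m\<in>K. c m * monval x m) = 0" "m \<in> K"
  shows "c m = 0"
  using assms
proof (induction K arbitrary: c m rule: finite_induct)
  case (insert m0 K)
  have mult: "monval (\<lambda>i. x i * y i) m = monval x m * monval y m" for x y :: "nat \<Rightarrow> real" and m
    by (simp add: monval_def power_mult_distrib prod.distrib)
  have zero: "c m = 0" if m: "m \<in> K" for m
  proof -
    from m insert.hyps obtain i where i: "Poly_Mapping.lookup m i \<noteq> Poly_Mapping.lookup m0 i"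
      by (metis poly_mapping_eqI)
    \<comment> \<open>The point \<open>y\<close> sees only the exponent of \<open>i\<close>, in
      which \<open>m\<close> and \<open>m0\<close> differ; the base 2 turns different exponents into
      different values.\<close>
    define y :: "nat \<Rightarrow> real" where "y = (\<lambda>j. if j = i then 2 else 1)"
    have mon_y: "monval y m' = 2 ^ Poly_Mapping.lookup m' i" for m'
    proof -
      have "monval y m' = (\<Prod>j\<in>insert i (Poly_Mapping.keys m'). y j ^ Poly_Mapping.lookup m' j)"
        by (rule monval_superset) auto
      also have "\<dots> = (\<Prod>j\<in>{i}. y j ^ Poly_Mapping.lookup m' j)"
        by (rule prod.mono_neutral_right) (auto simp: y_def)
      finally show ?thesis by (simp add: y_def)
    qed
    \<comment> \<open>Replacing \<open>x\<close> by the pointwise product of \<open>x\<close> and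
      \<open>y\<close> and subtracting \<open>monval y m0\<close> times the original relation
      cancels the term of \<open>m0\<close>.\<close>
    have "(\<Sum>m\<in>K. (c m * (monval y m - monval y m0)) * monval x m) = 0" for x
    proof -
      have "(\<Sum>m\<in>insert m0 K. c m * monval (\<lambda>i. x i * y i) m) - monval y m0 * (\<Sum>m\<in>insert m0 K. c m * monval x m) = 0"
        using insert.prems(1) by simp
      then show ?thesis
        using insert.hyps by (simp add: mult sum_distrib_left sum_subtractf algebra_simps)
    qed
    from insert.IH[OF this m] have "c m = 0 \<or> monval y m = monval y m0" by simp
    with i show ?thesis by (simp add: mon_y)
  qed
  \<comment> \<open>At the point with all coordinates 1 only the term of \<open>m0\<close> is
    left.\<close>
  have "c m0 = 0"
    using insert.prems(1)[of "\<lambda>_. 1"] insert.hyps zero by (simp add: monval_def)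
  with zero insert.prems(2) show ?case by auto
qed simp

lemma meval_eq_0_imp_eq_0:
  assumes "\<And>x. meval P x = 0"
  shows "P = 0"
proof (rule poly_mapping_eqI)
  fix m
  show "Poly_Mapping.lookup P m = Poly_Mapping.lookup 0 m"
    using monval_lin_indep[of "Poly_Mapping.keys P" "Poly_Mapping.lookup P" m] assms
    by (cases "m \<in> Poly_Mapping.keys P") (auto simp: meval_conv_monval in_keys_iff)
qed

lemma meval_Var [simp]: "meval (Var i) x = x i"
  by (simp add: meval_def msubst_single Var_def monval_single)

text \<open>The terms divisible by \<open>Var i\<close> go to \<open>Q\<close>, the others to
  \<open>P0\<close>. The induction adds the terms of \<open>P\<close> one at a time.\<close>

lemma split_Var:
  fixes P :: "'a::comm_semiring_1 mpoly"
  shows "\<exists>Q P0. P = Var i * Q + P0 \<and> i \<notin> indets P0"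
proof -
  have "\<exists>Q P0. (\<Sum>m\<in>K. Poly_Mapping.single m (Poly_Mapping.lookup P m)) = Var i * Q + P0 \<and> i \<notin> indets P0"
    if "finite K" for K
    using that
  proof (induction K rule: finite_induct)
    case empty
    show ?case by (intro exI[of _ 0]) (simp add: indets_def)
  next
    case (insert m K)
    then obtain Q P0 where IH: "(\<Sum>m\<in>K. Poly_Mapping.single m (Poly_Mapping.lookup P m)) = Var i * Q + P0"
        "i \<notin> indets P0" by auto
    let ?c = "Poly_Mapping.lookup P m"
    show ?case
    proof (cases "i \<in> Poly_Mapping.keys m")
      case True
      have "m = Poly_Mapping.single i 1 + (m - Poly_Mapping.single i 1)"
        using True by (intro poly_mapping_eqI) (auto simp: lookup_add lookup_minus lookup_single in_keys_iff when_def)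
      then have "Poly_Mapping.single m ?c = Var i * Poly_Mapping.single (m - Poly_Mapping.single i 1) ?c"
        by (simp add: Var_def mult_single)
      then show ?thesis using insert.hyps IH
        by (intro exI[of _ "Poly_Mapping.single (m - Poly_Mapping.single i 1) ?c + Q"] exI[of _ P0])
          (simp add: distrib_left add.assoc)
    next
      case False
      have "indets (Poly_Mapping.single m ?c + P0) \<subseteq> Poly_Mapping.keys m \<union> indets P0"
        using keys_add[of "Poly_Mapping.single m ?c" P0]
        by (auto simp: indets_def split: if_splits)
      then show ?thesis using insert.hyps IH False
        by (intro exI[of _ Q] exI[of _ "Poly_Mapping.single m ?c + P0"]) (auto simp: ac_simps)
    qed
  qed
  from this[of "Poly_Mapping.keys P"] show ?thesis by (simp flip: mpoly_eq_sum_single)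
qed

lemma meval_cong_indets:
  assumes "\<And>i. i \<in> indets P \<Longrightarrow> x i = y i"
  shows "meval P x = meval P y"
proof -
  have "monval x m = monval y m" if "m \<in> Poly_Mapping.keys P" for m
    unfolding monval_def
  proof (rule prod.cong[OF refl])
    fix i assume "i \<in> Poly_Mapping.keys m"
    with that have "x i = y i" by (intro assms) (auto simp: indets_def)
    then show "x i ^ Poly_Mapping.lookup m i = y i ^ Poly_Mapping.lookup m i" by simp
  qed
  then show ?thesis by (simp add: meval_conv_monval)
qed

text \<open>The remainder \<open>P0\<close> from \<open>split_Var\<close> does not involve the
  variable \<open>i\<close>, so each of its values is a value of \<open>P\<close> on the hyperplane
  where that variable is 0. Hence \<open>P0\<close> vanishes everywhere and is zero.\<close>

lemma Var_dvd_if_vanishes: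
  fixes P :: "real mpoly"
  assumes "\<And>x. meval P (x(i := 0)) = 0"
  shows "Var i dvd P"
proof -
  obtain Q P0 where P: "P = Var i * Q + P0" and i: "i \<notin> indets P0"
    using split_Var by blast
  have "meval P0 x = 0" for x
  proof -
    interpret comm_ring_hom "\<lambda>P. meval P (x(i := 0))" by (rule comm_ring_hom_meval)
    have "meval P0 x = meval P0 (x(i := 0))"
      by (rule meval_cong_indets) (use i in auto)
    with assms[of x] show ?thesis by (simp add: P hom_distribs)
  qed
  then have "P0 = 0" by (rule meval_eq_0_imp_eq_0)
  with P show ?thesis by simp
qed

section \<open>Polynomials in finitely many variables\<close>

lemma indets_add: "indets (F + G) \<subseteq> indets F \<union> indets G"
  using keys_add[of F G] by (auto simp: indets_def)

lemma indets_mult: "indets (F * G) \<subseteq> indets F \<union> indets G"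
proof -
  have "Poly_Mapping.keys m \<subseteq> indets F \<union> indets G" if "m \<in> Poly_Mapping.keys (F * G)" for m
  proof -
    from that keys_mult[of F G] obtain a b
      where "m = a + b" "a \<in> Poly_Mapping.keys F" "b \<in> Poly_Mapping.keys G" by blast
    with keys_add[of a b] show ?thesis unfolding indets_def by blast
  qed
  then show ?thesis by (subst indets_def) blast
qed

lemma indets_0 [simp]: "indets 0 = {}" and indets_1 [simp]: "indets 1 = {}"
  by (simp_all add: indets_def)

lemma indets_uminus [simp]: "indets (- F) = indets (F :: 'a::comm_ring_1 mpoly)"
proof -
  have "Poly_Mapping.keys (- F) = Poly_Mapping.keys F"
    by (auto simp: in_keys_iff)
  then show ?thesis by (simp add: indets_def)
qed

lemma indets_Const [simp]: "indets (Const c) = {}" and indets_Var [simp]: "indets (Var i) \<subseteq> {i}"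
  by (auto simp: indets_def Const_def Var_def split: if_splits)

lemma indets_sum: "(\<And>i. i \<in> A \<Longrightarrow> indets (f i) \<subseteq> V) \<Longrightarrow> indets (sum f A) \<subseteq> V"
proof (induction A rule: infinite_finite_induct)
  case (insert a A)
  then show ?case using indets_add[of "f a" "sum f A"] by auto
qed simp_all

lemma indets_prod: "(\<And>i. i \<in> A \<Longrightarrow> indets (f i) \<subseteq> V) \<Longrightarrow> indets (prod f A) \<subseteq> V"
proof (induction A rule: infinite_finite_induct)
  case (insert a A)
  then show ?case using indets_mult[of "f a" "prod f A"] by auto
qed simp_all

text \<open>By the Leibniz expansion: the signs are constants, and a non-square matrix has
  determinant 0 by definition.\<close>

lemma indets_det:
  fixes A :: "'a::comm_ring_1 mpoly mat"
  assumes "\<And>i j. i < dim_row A \<Longrightarrow> j < dim_col A \<Longrightarrow> indets (A $$ (i, j)) \<subseteq> V"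
  shows "indets (det A) \<subseteq> V"
proof (cases "dim_row A = dim_col A")
  case True
  have "indets (signof p * (\<Prod>i = 0..<dim_row A. A $$ (i, p i))) \<subseteq> V"
    if "p permutes {0..<dim_row A}" for p
  proof -
    have "indets (signof p :: 'a mpoly) = {}"
      by (simp add: sign_def)
    moreover have "indets (\<Prod>i = 0..<dim_row A. A $$ (i, p i)) \<subseteq> V"
      using permutes_in_image[OF that] assms True by (intro indets_prod) auto
    ultimately show ?thesis using indets_mult by fastforce
  qed
  then show ?thesis using True by (auto simp: det_def intro!: indets_sum)
qed (simp add: det_def)

lemma indets_resultant:
  fixes p q :: "'a::comm_ring_1 mpoly poly"
  assumes "\<And>k. indets (coeff p k) \<subseteq> V" "\<And>k. indets (coeff q k) \<subseteq> V"
  shows "indets (resultant p q) \<subseteq> V"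
  unfolding resultant_def
  by (rule indets_det) (use assms in \<open>auto simp: sylvester_index_mat\<close>)

text \<open>Multiplication by \<open>Var i ^ p\<close> shifts exponent vectors injectively, so
  nothing cancels and every variable of \<open>R\<close> survives in the product.\<close>

lemma indets_Var_power_mult:
  fixes R :: "'a::comm_semiring_1 mpoly"
  assumes "indets (Var i ^ p * R) \<subseteq> V"
  shows "indets R \<subseteq> V"
proof -
  let ?e = "Poly_Mapping.single i p"
  have Var_power: "Var i ^ p = Poly_Mapping.single ?e (1 :: 'a)"
    by (induction p) (simp_all add: Var_def mult_single flip: single_add)
  have "Poly_Mapping.lookup (Var i ^ p * R) (?e + m) = Poly_Mapping.lookup R m" for m
  proof -
    have "Var i ^ p * R = (\<Sum>m\<in>Poly_Mapping.keys R. Poly_Mapping.single (?e + m) (Poly_Mapping.lookup R m))"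
      by (subst mpoly_eq_sum_single[of R]) (simp add: Var_power sum_distrib_left mult_single)
    then show ?thesis
      by (auto simp: lookup_sum lookup_single when_def in_keys_iff)
  qed
  then have "?e + m \<in> Poly_Mapping.keys (Var i ^ p * R)" if "m \<in> Poly_Mapping.keys R" for m
    using that by (simp add: in_keys_iff)
  moreover have "Poly_Mapping.keys m \<subseteq> Poly_Mapping.keys (?e + m)" for m
    by (auto simp: in_keys_iff lookup_add)
  ultimately show ?thesis using assms by (fastforce simp: indets_def)
qed

section \<open>The resultant as a product over roots\<close>

text \<open>Numbering the roots, instead of keeping them in a multiset, allows products over pairs
  of roots to be split by the order of the indices.\<close>

lemma poly_linear_factors:
  fixes p :: "'a::alg_closed_field poly"
  assumes "p \<noteq> 0"
  obtains r where "p = smult (lead_coeff p) (\<Prod>j<degree p. [:- r j, 1:])"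
proof -
  obtain A where A: "size A = degree p" "p = smult (lead_coeff p) (\<Prod>x\<in>#A. [:-x, 1:])"
    using alg_closed_imp_factorization[OF assms] by blast
  obtain xs where xs: "A = mset xs" by (metis ex_mset)
  have "(\<Prod>x\<in>#A. [:-x, 1:]) = (\<Prod>j<degree p. [:- (xs ! j), 1:])"
    using A(1) by (simp add: xs prod.list_conv_set_nth atLeast0LessThan prod_mset_prod_list del: mset_map flip: mset_map)
  with A(2) that show ?thesis by metis
qed

lemma degree_prod_linear: "degree (\<Prod>j<n. [:- r j, 1:]) = (n :: nat)"
  for r :: "nat \<Rightarrow> 'a::idom"
  by (subst degree_prod_eq_sum_degree) auto

lemma monic_prod_linear: "coeff (\<Prod>j<n. [:- r j, 1:]) n = 1"
  for r :: "nat \<Rightarrow> 'a::idom"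
  using lead_coeff_prod[of "\<lambda>j. [:- r j, 1:]" "{..<n}"] unfolding degree_prod_linear by simp

\<comment> \<open>The simplifier rewrites \<open>[:1:]\<close> inside a linear factor to \<open>1\<close>.\<close>
lemmas prod_linear_simps [simp] =
  degree_prod_linear[unfolded pCons_one] monic_prod_linear[unfolded pCons_one]

text \<open>Vieta's formula for the second highest coefficient. It later yields the leading
  coefficient of the imaginary part.\<close>

lemma coeff_prod_linear: "coeff (\<Prod>j<Suc n. [:- r j, 1:]) n = - (\<Sum>j<Suc n. r j)"
  for r :: "nat \<Rightarrow> 'a::idom"
proof (induction n)
  case (Suc n)
  have "coeff (\<Prod>j<Suc n. [:- r j, 1:]) (Suc n) = 1"
    by (rule monic_prod_linear)
  then show ?case using Suc
    by (simp add: prod.lessThan_Suc[of _ "Suc n"] del: prod.lessThan_Suc)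
qed simp

text \<open>One step of the Euclidean algorithm. Subresultant theory gives it for
  \<open>resultant G F\<close> up to a sign, and swapping the arguments cancels that sign.\<close>

lemma resultant_mod:
  fixes F G :: "'a::field_gcd poly"
  assumes F: "degree F > 0" and FG: "degree F \<le> degree G"
  shows "resultant F G = lead_coeff F ^ (degree G - degree (G mod F)) * resultant F (G mod F)"
proof -
  let ?H = "G mod F"
  have F0: "F \<noteq> 0" and G0: "G \<noteq> 0" using assms by auto
  have "G + (- (G div F)) * F = ?H"
    by (simp add: algebra_simps minus_div_mult_eq_mod [symmetric])
  moreover have lt: "degree ?H < degree F"
    using degree_mod_less'[OF F0, of G] F by (cases "?H = 0") auto
  ultimately have *: "G + (- (G div F)) * F = ?H" "degree F \<le> degree G"
      "degree ?H < degree F \<or> ?H = 0 \<and> G \<noteq> 0 \<and> F \<noteq> 0"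
    using FG by auto
  let ?s = "(-1) ^ (degree G * degree F) :: 'a"
  have "resultant G F = ?s * lead_coeff F ^ (degree G - degree ?H) * resultant F ?H"
  \<comment> \<open>The resultant is the subresultant of index 0. A constant remainder is separate
    because this index then equals its degree.\<close>
  proof (cases "degree ?H = 0")
    case False
    then show ?thesis
      using BT_lemma_1_12[OF *, of 0] by (simp add: subresultant_resultant)
  next
    case True
    then obtain c where c: "?H = [:c:]" by (rule degree_eq_zeroE)
    have "subresultant 0 G F = smult (?s * lead_coeff F ^ degree G * lead_coeff ?H ^ (degree F - 1)) ?H"
      using BT_lemma_1_13[OF *] lt True by simp
    then have "resultant G F = ?s * lead_coeff F ^ degree G * (c ^ (degree F - 1) * c)"
      by (simp add: subresultant_resultant c)
    also have "c ^ (degree F - 1) * c = c ^ degree F"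
      using F by (metis Suc_diff_1 power_Suc2)
    finally show ?thesis by (simp add: c)
  qed
  moreover have "resultant F G = ?s * resultant G F"
    by (subst resultant_swap) (simp add: mult.commute)
  moreover have "?s * ?s = 1"
    by (simp flip: power_mult_distrib)
  ultimately show ?thesis by (simp add: mult.assoc[symmetric])
qed

text \<open>Poisson's product formula, by the Euclidean algorithm and induction on the sum of the
  degrees. Reducing \<open>G\<close> modulo the first polynomial keeps its values at the roots. If
  \<open>G\<close> has the smaller degree, \<open>G\<close> is factored too and the roles are
  exchanged.\<close>

lemma resultant_eq_prod:
  fixes G :: "'a::{alg_closed_field, field_gcd} poly" and m :: nat
  assumes "a \<noteq> 0"
  shows "resultant (smult a (\<Prod>j<m. [:- \<alpha> j, 1:])) G = a ^ degree G * (\<Prod>j<m. poly G (\<alpha> j))"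
  using assms
proof (induction "m + degree G" arbitrary: a m \<alpha> G rule: less_induct)
  case less
  let ?F = "smult a (\<Prod>j<m. [:- \<alpha> j, 1:])"
  have degF: "degree ?F = m" and lcF: "lead_coeff ?F = a"
    using less.prems by simp_all
  have root: "poly (G mod ?F) (\<alpha> j) = poly G (\<alpha> j)" if "j < m" for j G
  proof -
    have "poly ?F (\<alpha> j) = 0" using that by (auto simp: poly_prod)
    then have "poly (G div ?F * ?F + G mod ?F) (\<alpha> j) = poly (G mod ?F) (\<alpha> j)"
      unfolding poly_add poly_mult by simp
    then show ?thesis by (simp only: div_mult_mod_eq)
  qed
  show ?case
  proof (cases "m = 0 \<or> degree G = 0")
    case True
    then show ?thesis
    proof
      assume "degree G = 0"
      then obtain c where "G = [:c:]" by (rule degree_eq_zeroE)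
      then show ?thesis using degF by simp
    qed simp
  next
    case False
    show ?thesis
    proof (cases "m \<le> degree G")
      case True
      let ?H = "G mod ?F"
      have "?F \<noteq> 0" using less.prems by (metis degF degree_0 False)
      then have lt: "degree ?H < m"
        using degree_mod_less'[of ?F G] False degF by (cases "?H = 0") auto
      have "resultant ?F G = a ^ (degree G - degree ?H) * resultant ?F ?H"
        using resultant_mod[of ?F G] True False unfolding degF lcF by simp
      also have "resultant ?F ?H = a ^ degree ?H * (\<Prod>j<m. poly ?H (\<alpha> j))"
        using less.hyps[of m ?H a \<alpha>] lt True less.prems by simp
      also have "(\<Prod>j<m. poly ?H (\<alpha> j)) = (\<Prod>j<m. poly G (\<alpha> j))"
        by (rule prod.cong[OF refl], rule root) simp
      finally show ?thesis using lt True by (simp flip: mult.assoc power_add)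
    next
      case lt: False
      define b n where "b = lead_coeff G" and "n = degree G"
      have "G \<noteq> 0" using False by auto
      then obtain \<beta> where G: "G = smult b (\<Prod>k<n. [:- \<beta> k, 1:])" and b: "b \<noteq> 0"
        using poly_linear_factors[of G] unfolding b_def n_def by (metis leading_coeff_0_iff)
      let ?H = "?F mod G"
      have ltH: "degree ?H < n"
        using degree_mod_less'[of G ?F] False \<open>G \<noteq> 0\<close> by (cases "?H = 0") (auto simp: n_def)
      have rootG: "poly ?H (\<beta> k) = poly ?F (\<beta> k)" if "k < n" for k
      proof -
        have "poly G (\<beta> k) = 0" using that by (auto simp: G poly_prod)
        then have "poly (?F div G * G + ?H) (\<beta> k) = poly ?H (\<beta> k)"
          unfolding poly_add poly_mult by simp
        then show ?thesis by (simp only: div_mult_mod_eq)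
      qed
      have IH: "resultant (smult b (\<Prod>k<n. [:- \<beta> k, 1:])) ?H = b ^ degree ?H * (\<Prod>k<n. poly ?H (\<beta> k))"
        by (rule less.hyps) (use ltH lt b in \<open>auto simp: n_def\<close>)
      have "resultant G ?F = b ^ (m - degree ?H) * resultant G ?H"
        using resultant_mod[of G ?F] lt False unfolding degF b_def by simp
      also have "resultant G ?H = b ^ degree ?H * (\<Prod>k<n. poly ?H (\<beta> k))"
        by (rule IH[folded G])
      also have "(\<Prod>k<n. poly ?H (\<beta> k)) = (\<Prod>k<n. a * (\<Prod>j<m. \<beta> k - \<alpha> j))"
      proof (rule prod.cong[OF refl])
        fix k assume "k \<in> {..<n}"
        then have "poly ?H (\<beta> k) = poly ?F (\<beta> k)" by (intro rootG) simp
        then show "poly ?H (\<beta> k) = a * (\<Prod>j<m. \<beta> k - \<alpha> j)" by (simp add: poly_prod)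
      qed
      \<comment> \<open>Turning the differences around produces the sign
        \<open>(-1) ^ (m * n)\<close>, which the final swap of the resultant removes.\<close>
      also have "\<dots> = a ^ n * (\<Prod>k<n. \<Prod>j<m. - 1 * (\<alpha> j - \<beta> k))"
        by (simp add: prod.distrib)
      also have "(\<Prod>k<n. \<Prod>j<m. - 1 * (\<alpha> j - \<beta> k)) = (-1) ^ (m * n) * (\<Prod>k<n. \<Prod>j<m. \<alpha> j - \<beta> k)"
        by (simp only: prod.distrib prod_constant card_lessThan power_mult)
      also have "(\<Prod>k<n. \<Prod>j<m. \<alpha> j - \<beta> k) = (\<Prod>j<m. \<Prod>k<n. \<alpha> j - \<beta> k)"
        by (rule prod.swap)
      finally have res: "resultant G ?F = b ^ (m - degree ?H) * (b ^ degree ?H *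
          (a ^ n * ((-1) ^ (m * n) * (\<Prod>j<m. \<Prod>k<n. \<alpha> j - \<beta> k))))" .
      have "b ^ (m - degree ?H) * b ^ degree ?H = b ^ m"
        using ltH lt by (simp add: n_def flip: power_add)
      moreover have "x * (y * (c * (t * p))) = t * (c * (z * p))" if "x * y = z" for x y z c t p :: 'a
        unfolding that[symmetric] by (simp only: mult_ac)
      ultimately have "resultant G ?F = (-1) ^ (m * n) * (a ^ n * (b ^ m * (\<Prod>j<m. \<Prod>k<n. \<alpha> j - \<beta> k)))"
        unfolding res by blast
      moreover have "(\<Prod>j<m. poly G (\<alpha> j)) = b ^ m * (\<Prod>j<m. \<Prod>k<n. \<alpha> j - \<beta> k)"
        by (simp add: G poly_prod prod.distrib)
      moreover have "resultant ?F G = (-1) ^ (m * n) * resultant G ?F"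
        by (subst resultant_swap) (simp only: degF n_def)
      moreover have "(-1) ^ (m * n) * (-1) ^ (m * n) = (1 :: 'a)"
        by (simp flip: power_mult_distrib)
      ultimately show ?thesis by (simp add: n_def flip: mult.assoc)
    qed
  qed
qed

text \<open>At the roots of \<open>G\<close> the two polynomials \<open>F\<close> and
  \<open>F + Q * G\<close> agree, so the product formula for \<open>resultant G\<close> gives the
  same value. Equal degrees give the same power of the leading coefficient of \<open>G\<close> and
  the same sign in the swap.\<close>

lemma resultant_add_mult_left:
  fixes F G :: "'a::{alg_closed_field, field_gcd} poly"
  assumes "degree (F + Q * G) = degree F"
  shows "resultant (F + Q * G) G = resultant F G"
proof (cases "G = 0")
  case False
  define b n where "b = lead_coeff G" and "n = degree G"
  obtain \<beta> where G: "G = smult b (\<Prod>k<n. [:- \<beta> k, 1:])" and b: "b \<noteq> 0"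
    using False poly_linear_factors[of G] unfolding b_def n_def by (metis leading_coeff_0_iff)
  have eq: "resultant G F = b ^ degree F * (\<Prod>k<n. poly F (\<beta> k))" for F
    using resultant_eq_prod[OF b, of \<beta> n F] unfolding G[symmetric] .
  have "poly G (\<beta> k) = 0" if "k < n" for k
    using that by (auto simp: G poly_prod)
  then have "resultant G (F + Q * G) = resultant G F"
    unfolding eq assms by simp
  then show ?thesis
    by (subst (1 2) resultant_swap) (simp add: assms)
qed simp

section \<open>Specialization at a point\<close>

lemma comm_ring_hom_const: "comm_ring_hom (\<lambda>c::'a::comm_ring_1. [:c:])"
  by unfold_locales (auto simp: pCons_one)

lemma comm_ring_hom_poly: "comm_ring_hom (\<lambda>p::'a::comm_ring_1 poly. poly p s)"
  by unfold_locales auto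

lemma comm_ring_hom_pcompose: "comm_ring_hom (\<lambda>p::'a::comm_ring_1 poly. p \<circ>\<^sub>p q)"
  by unfold_locales (auto simp: pcompose_add pcompose_mult pcompose_1)

text \<open>Restriction to the line through \<open>a\<close> in the direction of the variable 0. For
  \<open>F\<close> the line parameter is \<open>t\<close>; for the resultant it is
  \<open>t_2\<close>, since both are encoded as \<open>Var 0\<close>.\<close>

definition spec :: "(nat \<Rightarrow> real) \<Rightarrow> real mpoly \<Rightarrow> real poly" where
  "spec a F = msubst (\<lambda>c. [:c:]) (\<lambda>i. if i = 0 then [:0, 1:] else [:a i:]) F"

lemma comm_ring_hom_spec: "comm_ring_hom (spec a)"
  unfolding spec_def by (rule comm_ring_hom.comm_ring_hom_msubst[OF comm_ring_hom_const])

lemma poly_spec: "poly (spec a F) s = meval F (a(0 := s))"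
  unfolding spec_def meval_def comm_ring_hom.hom_msubst[OF comm_ring_hom_poly]
  by (rule arg_cong2[where f = "\<lambda>h x. msubst h x F"]) auto

lemma spec_Var_0: "spec a (Var 0) = [:0, 1:]"
  by (simp add: spec_def Var_def msubst_single monval_single pCons_one)

text \<open>The bounds need not be attained: if one of them is strict, both sides of the coefficient
  identity are 0.\<close>

lemma degree_coeff_prod:
  fixes p :: "'i \<Rightarrow> 'a::comm_semiring_1 poly"
  assumes "finite A" "\<And>i. i \<in> A \<Longrightarrow> degree (p i) \<le> k i"
  shows "degree (\<Prod>i\<in>A. p i) \<le> (\<Sum>i\<in>A. k i) \<and>
    coeff (\<Prod>i\<in>A. p i) (\<Sum>i\<in>A. k i) = (\<Prod>i\<in>A. coeff (p i) (k i))"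
  using assms
proof (induction A rule: finite_induct)
  case (insert i A)
  then have IH: "degree (prod p A) \<le> sum k A" "coeff (prod p A) (sum k A) = (\<Prod>i\<in>A. coeff (p i) (k i))"
    and i: "degree (p i) \<le> k i" by auto
  have "degree (p i * prod p A) \<le> k i + sum k A"
    using degree_mult_le[of "p i" "prod p A"] i IH(1) by linarith
  moreover have "coeff (p i * prod p A) (k i + sum k A) = coeff (p i) (k i) * coeff (prod p A) (sum k A)"
  proof (cases "degree (p i) = k i \<and> degree (prod p A) = sum k A")
    case True
    then show ?thesis by (metis coeff_mult_degree_sum)
  next
    case False
    with i IH(1) have "degree (p i) < k i \<or> degree (prod p A) < sum k A" by auto
    then have "coeff (p i) (k i) * coeff (prod p A) (sum k A) = 0"
      by (auto simp: coeff_eq_0)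
    moreover have "degree (p i * prod p A) < k i + sum k A"
      using degree_mult_le[of "p i" "prod p A"] i IH(1) False by linarith
    ultimately show ?thesis by (simp add: coeff_eq_0)
  qed
  ultimately show ?case using insert.hyps IH(2) by simp
qed simp

lemma degree_coeff_power:
  fixes p :: "'a::comm_semiring_1 poly"
  assumes "degree p \<le> 1"
  shows "degree (p ^ k) \<le> k \<and> coeff (p ^ k) k = coeff p 1 ^ k"
  using degree_coeff_prod[of "{..<k}" "\<lambda>_. p" "\<lambda>_. 1"] assms by simp

text \<open>The value substituted for variable \<open>i\<close> has linear coefficient
  \<open>e0 i\<close>. So the coefficient of \<open>t^d\<close> in a monomial of degree
  \<open>d\<close> is the value of that monomial at \<open>e0\<close>, and these add up to
  \<open>meval F e0\<close>.\<close>

lemma monic_spec_form: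
  assumes "is_form d F" "meval F e0 = 1"
  shows "degree (spec a F) = d" "coeff (spec a F) d = 1"
proof -
  define x where "x = (\<lambda>i::nat. if i = 0 then [:0, 1:] else [:a i:])"
  have x: "degree (x i) \<le> 1" "coeff (x i) 1 = e0 i" for i by (auto simp: x_def e0_def)
  have mon_x: "degree (monval x m) \<le> d \<and> coeff (monval x m) d = monval e0 m"
    if "m \<in> Poly_Mapping.keys F" for m
  proof -
    have d: "(\<Sum>i\<in>Poly_Mapping.keys m. Poly_Mapping.lookup m i) = d"
      using assms(1) that by (simp add: is_form_def)
    show ?thesis
      using degree_coeff_prod[of "Poly_Mapping.keys m" "\<lambda>i. x i ^ Poly_Mapping.lookup m i" "Poly_Mapping.lookup m"]
        degree_coeff_power[OF x(1)] unfolding monval_def d x(2) by simp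
  qed
  have spec: "spec a F = (\<Sum>m\<in>Poly_Mapping.keys F. smult (Poly_Mapping.lookup F m) (monval x m))"
    by (simp add: spec_def msubst_def monval_def x_def)
  have "degree (spec a F) \<le> d"
    unfolding spec using mon_x by (intro degree_sum_le) (auto intro: order_trans[OF degree_smult_le])
  moreover show c: "coeff (spec a F) d = 1"
    using mon_x assms(2) by (simp add: spec coeff_sum meval_conv_monval)
  ultimately show "degree (spec a F) = d"
    by (metis le_degree order_antisym zero_neq_one)
qed

text \<open>The coordinate 0 of \<open>a\<close> only translates the argument by a real number,
  which preserves real-rootedness, and \<open>-a\<close> ranges over all points as \<open>a\<close>
  does.\<close>

lemma hyperbolic_e0_iff:
  "hyperbolic F e0 \<longleftrightarrow> meval F e0 \<noteq> 0 \<and> (\<forall>a. real_rooted (spec a F))"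
proof -
  have shift: "msubst (\<lambda>c. [:c:]) (\<lambda>i. [:- a i, e0 i:]) F = spec (\<lambda>i. - a i) F \<circ>\<^sub>p [:- a 0, 1:]" for a
  unfolding spec_def comm_ring_hom.hom_msubst[OF comm_ring_hom_pcompose]
    by (rule arg_cong2[where f = "\<lambda>h x. msubst h x F"]) (auto simp: e0_def pcompose_pCons)
  have root: "poly (map_poly complex_of_real (p \<circ>\<^sub>p [:- c, 1:])) z = poly (map_poly complex_of_real p) (z - of_real c)"
    for p c z by (simp add: of_real_hom.map_poly_pcompose poly_pcompose)
  have rr: "real_rooted (p \<circ>\<^sub>p [:- c, 1:]) \<longleftrightarrow> real_rooted p" for p c
    unfolding real_rooted_def root
    by (metis Reals_diff Reals_add Reals_of_real diff_add_cancel add_diff_cancel)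
  have "(\<forall>a. real_rooted (spec (\<lambda>i. - a i) F)) \<longleftrightarrow> (\<forall>a. real_rooted (spec a F))"
    by (metis (no_types, lifting) minus_minus ext)
  then show ?thesis unfolding hyperbolic_def shift rr by simp
qed

section \<open>The real and imaginary parts\<close>

text \<open>Polynomials with all coefficients in the variables up to \<open>n\<close> are closed
  under the ring operations that build \<open>cplx_shift F\<close>. Every monomial of a real or
  imaginary part already occurs in \<open>cplx_shift F\<close>.\<close>

lemma indets_re_im_parts:
  assumes F: "indets F \<subseteq> {..n}" and parts: "re_im_parts F fRe fIm"
  shows "indets (coeff fRe k) \<subseteq> {..n}" "indets (coeff fIm k) \<subseteq> {..n}"
proof -
  let ?P = "\<lambda>p :: complex mpoly poly. \<forall>k. indets (coeff p k) \<subseteq> {..n}"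
  have add: "?P (p + q)" if "?P p" "?P q" for p q
  proof
    show "indets (coeff (p + q) k) \<subseteq> {..n}" for k
      using that indets_add[of "coeff p k" "coeff q k"] by (auto simp: subset_iff)
  qed
  have mult: "?P (p * q)" if "?P p" "?P q" for p q
  proof
    show "indets (coeff (p * q) k) \<subseteq> {..n}" for k
      unfolding coeff_mult
    proof (rule indets_sum)
      fix i assume "i \<in> {..k}"
      show "indets (coeff p i * coeff q (k - i)) \<subseteq> {..n}"
        using that indets_mult[of "coeff p i" "coeff q (k - i)"] by blast
    qed
  qed
  have const: "?P [:c:]" if "indets c \<subseteq> {..n}" for c
    using that by (auto simp: coeff_pCons split: nat.splits)
  have one: "?P 1" using const[of 1] by (simp add: pCons_one)
  have power: "?P (p ^ k)" if "?P p" for p k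
    by (induction k) (use one mult that in auto)
  have prod: "?P (prod f A)" if "\<And>i. i \<in> A \<Longrightarrow> ?P (f i)" for f and A :: "nat set"
    using that by (induction A rule: infinite_finite_induct) (use one mult in auto)
  have sum: "?P (sum f A)" if "\<And>i. i \<in> A \<Longrightarrow> ?P (f i)" for f and A :: "(nat \<Rightarrow>\<^sub>0 nat) set"
    using that by (induction A rule: infinite_finite_induct) (use add in auto)
  have var: "?P (if i = 0 then [:Const \<i> * Var 0, 1:] else [:Var i:])" if "i \<le> n" for i
    using that indets_mult[of "Const \<i>" "Var 0"] indets_Var[of 0] indets_Var[of i]
    by (auto simp: coeff_pCons subset_iff split: nat.splits)
  have "?P (cplx_shift F)"
    unfolding cplx_shift_def msubst_def
  proof (intro sum mult prod power)
    fix m i assume "m \<in> Poly_Mapping.keys F" "i \<in> Poly_Mapping.keys m"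
    with F have "i \<le> n" by (auto simp: indets_def)
    then show "?P (if i = 0 then [:Const \<i> * Var 0, 1:] else [:Var i:])" by (rule var)
  qed (rule const, simp)
  then have *: "indets (coeff (cplx_shift F) k) \<subseteq> {..n}" by blast
  have lookup: "Poly_Mapping.lookup (coeff (cplx_shift F) k) m =
      Complex (Poly_Mapping.lookup (coeff fRe k) m) (Poly_Mapping.lookup (coeff fIm k) m)" for m
    using parts by (simp only: re_im_parts_def lookup_coeff_re_im)
  have "Poly_Mapping.keys (coeff fRe k) \<subseteq> Poly_Mapping.keys (coeff (cplx_shift F) k)"
       "Poly_Mapping.keys (coeff fIm k) \<subseteq> Poly_Mapping.keys (coeff (cplx_shift F) k)"
    by (auto simp: in_keys_iff lookup complex_eq_iff)
  with * show "indets (coeff fRe k) \<subseteq> {..n}" "indets (coeff fIm k) \<subseteq> {..n}"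
    by (auto simp: indets_def)
qed

text \<open>Both sides are the image of \<open>cplx_shift F\<close> under evaluation of its
  coefficients at the point \<open>a(0 := s)\<close>.\<close>

lemma re_im_parts_eval:
  assumes "re_im_parts F fRe fIm"
  shows "map_poly complex_of_real (spec a F) \<circ>\<^sub>p [:\<i> * of_real s, 1:] =
    map_poly (\<lambda>P. complex_of_real (meval P (a(0 := s)))) fRe +
    [:\<i>:] * map_poly (\<lambda>P. complex_of_real (meval P (a(0 := s)))) fIm"
proof -
  define x where "x = (\<lambda>i. complex_of_real ((a(0 := s)) i))"
  define ev :: "complex mpoly \<Rightarrow> complex" where "ev = msubst (\<lambda>c. c) x"
  have "comm_ring_hom (\<lambda>c::complex. c)" by unfold_locales auto
  then interpret ev: comm_ring_hom ev
    unfolding ev_def by (rule comm_ring_hom.comm_ring_hom_msubst)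
  interpret evp: map_poly_comm_ring_hom ev ..
  interpret orp: map_poly_comm_ring_hom complex_of_real ..
  have ev_Const: "ev (Const c) = c" and ev_Var: "ev (Var i) = x i" for c i
    by (simp_all add: ev_def Const_def Var_def msubst_single monval_single)
  have ev_of_real: "ev (Poly_Mapping.map complex_of_real P) = of_real (meval P (a(0 := s)))" for P
  proof -
    have "Poly_Mapping.keys (Poly_Mapping.map complex_of_real P) = Poly_Mapping.keys P"
      by (auto simp: in_keys_iff Poly_Mapping.map.rep_eq when_def)
    moreover have "monval x m = of_real (monval (a(0 := s)) m)" for m
      by (simp add: monval_def x_def)
    ultimately show ?thesis
      by (simp add: ev_def msubst_def meval_def Poly_Mapping.map.rep_eq when_def in_keys_iff
          del: fun_upd_apply flip: monval_def)
  qed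
  have const: "map_poly ev [:c:] = [:ev c:]" "map_poly complex_of_real [:b:] = [:of_real b:]" for b c
    by (intro poly_eqI; simp add: coeff_map_poly coeff_pCons split: nat.splits)+
  have map0: "Poly_Mapping.map complex_of_real 0 = 0"
    by (rule poly_mapping_eqI) (simp add: Poly_Mapping.map.rep_eq)
  have cplx: "map_poly ev (complexify p) = map_poly (\<lambda>P. complex_of_real (meval P (a(0 := s)))) p" for p
    unfolding complexify_def
    by (subst map_poly_map_poly) (simp_all add: map0 o_def ev_of_real)
  have "map_poly ev (cplx_shift F) = map_poly complex_of_real (spec a F) \<circ>\<^sub>p [:\<i> * of_real s, 1:]"
    unfolding cplx_shift_def spec_def
      comm_ring_hom.hom_msubst[OF evp.comm_ring_hom_axioms]
      comm_ring_hom.hom_msubst[OF orp.comm_ring_hom_axioms]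
      comm_ring_hom.hom_msubst[OF comm_ring_hom_pcompose]
    by (rule arg_cong2[where f = "\<lambda>h x. msubst h x F"]; rule ext)
      (simp_all add: const ev_Const ev_Var x_def pcompose_pCons map_poly_pCons ev.hom_mult)
  moreover have "map_poly ev [:Const \<i>:] = [:\<i>:]"
    by (simp only: const ev_Const)
  then have "map_poly ev (cplx_shift F) = map_poly ev (complexify fRe) + [:\<i>:] * map_poly ev (complexify fIm)"
    using assms by (simp only: re_im_parts_def evp.hom_add evp.hom_mult)
  ultimately show ?thesis by (simp add: cplx)
qed

lemma comm_ring_hom_of_real_meval: "comm_ring_hom (\<lambda>P. complex_of_real (meval P x))"
proof -
  interpret comm_ring_hom "\<lambda>P. meval P x" by (rule comm_ring_hom_meval)
  show ?thesis by unfold_locales (simp_all add: hom_add hom_mult)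
qed

section \<open>Values of the resultant in terms of the complex roots\<close>

abbreviation cspec :: "(nat \<Rightarrow> real) \<Rightarrow> real mpoly \<Rightarrow> complex poly" where
  "cspec a F \<equiv> map_poly complex_of_real (spec a F)"

lemma cspec_linear_factors:
  assumes "is_form d F" "meval F e0 = 1"
  obtains r where "cspec a F = (\<Prod>j<d. [:- r j, 1:])"
proof -
  have deg: "degree (cspec a F) = d" and lead: "lead_coeff (cspec a F) = 1"
    using monic_spec_form[OF assms, of a] by (simp_all add: coeff_map_poly)
  from lead have "cspec a F \<noteq> 0" by force
  then obtain r where "cspec a F = smult (lead_coeff (cspec a F)) (\<Prod>j<degree (cspec a F). [:- r j, 1:])"
    by (rule poly_linear_factors)
  then have "cspec a F = (\<Prod>j<d. [:- r j, 1:])"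
    unfolding lead unfolding deg smult_1_left .
  then show ?thesis by (rule that)
qed

text \<open>In the resultant the diagonal will give the power of \<open>s\<close>, and the pairs the
  quadratic factors.\<close>

lemma prod_square_split:
  fixes g :: "nat \<Rightarrow> nat \<Rightarrow> 'a::comm_monoid_mult"
  shows "(\<Prod>j<n. \<Prod>k<n. g j k) = (\<Prod>j<n. g j j) * (\<Prod>j<n. \<Prod>k<j. g j k * g k j)"
  by (induction n) (simp_all add: prod.distrib mult_ac)

context
  fixes F :: "real mpoly" and fRe fIm :: "real mpoly poly" and d :: nat
  assumes form: "is_form d F" and F_e0: "meval F e0 = 1" and parts: "re_im_parts F fRe fIm"
begin

context
  fixes a :: "nat \<Rightarrow> real" and s :: real and A B :: "complex poly" and r :: "nat \<Rightarrow> complex"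
  defines "A \<equiv> map_poly (\<lambda>P. complex_of_real (meval P (a(0 := s)))) fRe"
    and "B \<equiv> map_poly (\<lambda>P. complex_of_real (meval P (a(0 := s)))) fIm"
  assumes roots: "cspec a F = (\<Prod>j<d. [:- r j, 1:])"
begin

lemma coeff_A: "coeff A k = of_real (meval (coeff fRe k) (a(0 := s)))"
  and coeff_B: "coeff B k = of_real (meval (coeff fIm k) (a(0 := s)))"
  unfolding A_def B_def by (simp_all add: coeff_map_poly meval_def msubst_def)

lemma shift_roots: "cspec a F \<circ>\<^sub>p [:c, 1:] = (\<Prod>j<d. [:- (r j - c), 1:])"
  unfolding roots pcompose_prod by (simp add: pcompose_pCons)

lemma shift_plus: "A + [:\<i>:] * B = (\<Prod>j<d. [:- (r j - \<i> * s), 1:])"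
  unfolding shift_roots[symmetric] A_def B_def
  by (rule re_im_parts_eval[OF parts, symmetric])

text \<open>Conjugating coefficients in the previous identity fixes \<open>A\<close>,
  \<open>B\<close> and \<open>cspec a F\<close>, which are real, and turns the shift by
  \<open>\<i> * s\<close> into its negative.\<close>

lemma shift_minus: "A - [:\<i>:] * B = (\<Prod>j<d. [:- (r j - (- (\<i> * s))), 1:])"
proof -
  interpret cnj: comm_ring_hom cnj by unfold_locales auto
  interpret cnjp: map_poly_comm_ring_hom cnj ..
  have "map_poly cnj (cspec a F \<circ>\<^sub>p [:\<i> * s, 1:]) = map_poly cnj (A + [:\<i>:] * B)"
    unfolding A_def B_def by (subst re_im_parts_eval[OF parts]) simp
  moreover have "map_poly cnj [:\<i>:] = [:- \<i>:]" "map_poly cnj [:\<i> * s, 1:] = [:- (\<i> * s), 1:]"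
    by (auto intro!: poly_eqI simp: coeff_map_poly coeff_pCons split: nat.splits)
  moreover have "map_poly cnj A = A" "map_poly cnj B = B" "map_poly cnj (cspec a F) = cspec a F"
    by (auto intro!: poly_eqI simp: coeff_map_poly coeff_A coeff_B)
  ultimately have "cspec a F \<circ>\<^sub>p [:- (\<i> * s), 1:] = A + [:- \<i>:] * B"
    by (simp only: cnj.map_poly_pcompose cnjp.hom_add cnjp.hom_mult)
  then show ?thesis unfolding shift_roots by simp
qed

lemma coeff_A_eq: "coeff A k =
    (coeff (\<Prod>j<d. [:- (r j - \<i> * s), 1:]) k + coeff (\<Prod>j<d. [:- (r j - (- (\<i> * s))), 1:]) k) / 2"
  and coeff_B_eq: "coeff B k =
    (coeff (\<Prod>j<d. [:- (r j - \<i> * s), 1:]) k - coeff (\<Prod>j<d. [:- (r j - (- (\<i> * s))), 1:]) k) / (2 * \<i>)"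
  unfolding shift_plus[symmetric] shift_minus[symmetric] by (simp_all add: field_simps)

text \<open>\<open>A\<close> is the mean of two monic polynomials of degree \<open>d\<close>;
  \<open>B\<close> is a multiple of their difference, in which the leading terms cancel.\<close>

lemma coeff_A_top: "coeff A d = 1" and coeff_A_0: "k > d \<Longrightarrow> coeff A k = 0"
  and coeff_B_0: "k \<ge> d \<Longrightarrow> coeff B k = 0"
proof -
  have *: "coeff (\<Prod>j<d. [:- r j, 1:]) k = 0" if "k > d" for r :: "nat \<Rightarrow> complex" and k
    by (rule coeff_eq_0) (simp only: degree_prod_linear that)
  show "coeff A d = 1" unfolding coeff_A_eq monic_prod_linear by simp
  show "k > d \<Longrightarrow> coeff A k = 0" unfolding coeff_A_eq by (simp only: *) simp
  show "k \<ge> d \<Longrightarrow> coeff B k = 0" unfolding coeff_B_eq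
    by (cases "k = d") (simp_all only: * monic_prod_linear le_neq_implies_less, simp_all)
qed

text \<open>By Vieta, since the root sums of the two shifted polynomials differ by
  \<open>2 * \<i> * d * s\<close>.\<close>

lemma coeff_B_top: "d > 0 \<Longrightarrow> coeff B (d - 1) = of_nat d * s"
  using coeff_prod_linear[of "\<lambda>j. r j - \<i> * s" "d - 1"] coeff_prod_linear[of "\<lambda>j. r j - (- (\<i> * s))" "d - 1"]
  unfolding coeff_B_eq by (simp only: Suc_diff_1) (simp add: sum_subtractf sum.distrib field_simps)

end

text \<open>The coefficient vanishes at every real point: for \<open>s = x 0\<close> the point
  \<open>x(0 := s)\<close> is \<open>x\<close> itself.\<close>

lemma coeff_fRe_0:
  assumes "k > d"
  shows "coeff fRe k = 0"
proof (rule meval_eq_0_imp_eq_0)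
  fix x
  obtain r where roots: "cspec x F = (\<Prod>j<d. [:- r j, 1:])"
    by (rule cspec_linear_factors[OF form F_e0])
  from coeff_A_0[OF roots assms, of "x 0"]
  have "complex_of_real (meval (coeff fRe k) (x(0 := x 0))) = 0"
    unfolding coeff_A[OF roots] .
  then show "meval (coeff fRe k) x = 0" by simp
qed

lemma coeff_fIm_0:
  assumes "k \<ge> d"
  shows "coeff fIm k = 0"
proof (rule meval_eq_0_imp_eq_0)
  fix x
  obtain r where roots: "cspec x F = (\<Prod>j<d. [:- r j, 1:])"
    by (rule cspec_linear_factors[OF form F_e0])
  from coeff_B_0[OF roots assms, of "x 0"]
  have "complex_of_real (meval (coeff fIm k) (x(0 := x 0))) = 0"
    unfolding coeff_B[OF roots] .
  then show "meval (coeff fIm k) x = 0" by simp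
qed

text \<open>With \<open>G = A + \<i> B = \<Prod>\<^sub>j (t - (r\<^sub>j - \<i> s))\<close>, the resultant of \<open>A\<close> and \<open>B\<close> equals that of \<open>G\<close> and
  \<open>B\<close>, and at a root of \<open>G\<close> the polynomial \<open>B\<close> takes the value \<open>\<i>/2 \<cdot> \<Prod>\<^sub>k (r\<^sub>j - r\<^sub>k - 2 \<i> s)\<close>. The
  factor with \<open>k = j\<close> contributes \<open>s\<close>; the remaining factors are paired.\<close>

lemma meval_resultant:
  assumes s: "s \<noteq> 0" and roots: "cspec a F = (\<Prod>j<d. [:- r j, 1:])"
  shows "complex_of_real (meval (resultant fRe fIm) (a(0 := s))) =
    of_real s ^ d * (\<Prod>j<d. \<Prod>k<j. - (4 * of_real s ^ 2 + (r j - r k) ^ 2))"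
proof -
  define h where "h = (\<lambda>P. complex_of_real (meval P (a(0 := s))))"
  define A B where "A = map_poly h fRe" and "B = map_poly h fIm"
  define G where "G = (\<Prod>j<d. [:- (r j - \<i> * s), 1:])"
  interpret h: comm_ring_hom h unfolding h_def by (rule comm_ring_hom_of_real_meval)
  note AB = A_def[unfolded h_def] B_def[unfolded h_def]
  note facts = coeff_A_top[OF roots, of s, folded AB] coeff_B_top[OF roots, of s, folded AB]
    shift_plus[OF roots, of s, folded AB] shift_minus[OF roots, of s, folded AB]
  \<comment> \<open>For \<open>d > 0\<close>, the assumption \<open>s \<noteq> 0\<close> keeps the
    leading coefficient \<open>d * s\<close> of \<open>B\<close> nonzero. Thus evaluation preserves
    both degrees and commutes with the resultant.\<close>
  have degRe: "degree fRe \<le> d" and degIm: "degree fIm \<le> d - 1"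
    using coeff_fRe_0 coeff_fIm_0 by (auto intro!: degree_le)
  have degA: "degree A = d"
    using le_degree[of A d] facts(1) degree_map_poly_le[of h fRe] degRe unfolding A_def by force
  moreover have "degree B = d - 1"
  proof (cases "d = 0")
    case False
    then have "coeff B (d - 1) \<noteq> 0" using facts(2) s by simp
    then show ?thesis
      using le_degree[of B "d - 1"] degree_map_poly_le[of h fIm] degIm unfolding B_def by force
  qed (use degree_map_poly_le[of h fIm] degIm in \<open>simp add: B_def\<close>)
  ultimately have "degree A = degree fRe" "degree B = degree fIm"
    using degRe degIm degree_map_poly_le[of h fRe] degree_map_poly_le[of h fIm]
    unfolding A_def B_def by linarith+
  then have "h (resultant fRe fIm) = resultant A B"
    unfolding A_def B_def by (simp add: h.resultant_map_poly)
  also have "\<dots> = resultant (A + [:\<i>:] * B) B"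
    by (rule resultant_add_mult_left[symmetric]) (simp only: facts degree_prod_linear degA)
  also have "\<dots> = (\<Prod>j<d. poly B (r j - \<i> * s))"
    using resultant_eq_prod[of 1 "\<lambda>j. r j - \<i> * s" d B] unfolding facts by simp
  also have "\<dots> = (\<Prod>j<d. \<i> / 2 * (\<Prod>k<d. r j - r k - 2 * \<i> * s))"
  proof (rule prod.cong[OF refl])
    fix j assume j: "j \<in> {..<d}"
    have "poly (A + [:\<i>:] * B) (r j - \<i> * s) = 0"
      using j unfolding facts by (auto simp: poly_prod)
    moreover have "poly (A - [:\<i>:] * B) (r j - \<i> * s) = (\<Prod>k<d. r j - r k - 2 * \<i> * s)"
      unfolding facts by (simp add: poly_prod algebra_simps)
    \<comment> \<open>At a zero of \<open>A + \<i> B\<close> the value of \<open>A\<close> is that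
      of \<open>- \<i> B\<close>.\<close>
    moreover have "- 2 * \<i> * poly B y = x" if "poly (A + [:\<i>:] * B) y = 0" "poly (A - [:\<i>:] * B) y = x" for x y
      using that by (auto simp: add_eq_0_iff2)
    ultimately have "- 2 * \<i> * poly B (r j - \<i> * s) = (\<Prod>k<d. r j - r k - 2 * \<i> * s)"
      by blast
    then have "\<i> / 2 * (- 2 * \<i> * poly B (r j - \<i> * s)) = \<i> / 2 * (\<Prod>k<d. r j - r k - 2 * \<i> * s)"
      by simp
    then show "poly B (r j - \<i> * s) = \<i> / 2 * (\<Prod>k<d. r j - r k - 2 * \<i> * s)"
      by (simp add: algebra_simps)
  qed
  also have "\<dots> = (\<Prod>j<d. \<i> / 2) * ((\<Prod>j<d. r j - r j - 2 * \<i> * s) *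
      (\<Prod>j<d. \<Prod>k<j. (r j - r k - 2 * \<i> * s) * (r k - r j - 2 * \<i> * s)))"
    unfolding prod.distrib[of "\<lambda>_. \<i> / 2"] prod_square_split[of "\<lambda>j k. r j - r k - 2 * \<i> * s"] ..
  also have "\<dots> = (\<i> / 2 * - (2 * \<i> * s)) ^ d *
      (\<Prod>j<d. \<Prod>k<j. (r j - r k - 2 * \<i> * s) * (r k - r j - 2 * \<i> * s))"
    unfolding power_mult_distrib[of "\<i> / 2"] by (simp add: mult.assoc)
  also have "\<dots> = of_real s ^ d * (\<Prod>j<d. \<Prod>k<j. - (4 * of_real s ^ 2 + (r j - r k) ^ 2))"
    by (simp add: algebra_simps power2_eq_square)
  finally show ?thesis by (simp add: h_def)
qed

end

section \<open>The factorization of the resultant and the sign of the cofactor\<close>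

lemma complex_poly_eqI:
  fixes p q :: "complex poly"
  assumes "\<And>s::real. s \<noteq> 0 \<Longrightarrow> poly p (of_real s) = poly q (of_real s)"
  shows "p = q"
proof (rule ccontr)
  assume "p \<noteq> q"
  then have "finite {z. poly (p - q) z = 0}" by (intro poly_roots_finite) simp
  \<comment> \<open>The nonzero reals, where \<open>meval_resultant\<close> applies, are infinitely
    many roots of the difference.\<close>
  moreover have "complex_of_real ` (- {0}) \<subseteq> {z. poly (p - q) z = 0}"
    using assms by auto
  ultimately have "finite (complex_of_real ` (- {0}))" by (rule finite_subset[rotated])
  then have "finite (- {0 :: real})" by (rule finite_imageD) (auto simp: inj_on_def)
  then show False using infinite_UNIV_char_0[where 'a = real] by (simp add: finite_compl)
qed

text \<open>By continuity; this recovers the value at \<open>s = 0\<close>, which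
  \<open>meval_resultant\<close> leaves out.\<close>

lemma poly_nonneg_at_0:
  fixes p :: "real poly"
  assumes "\<And>s. s \<noteq> 0 \<Longrightarrow> 0 \<le> poly p s"
  shows "0 \<le> poly p 0"
proof (rule tendsto_lowerbound)
  show "(poly p \<longlongrightarrow> poly p 0) (at 0)"
    by (rule tendsto_poly[OF tendsto_ident_at])
  show "\<forall>\<^sub>F s in at 0. 0 \<le> poly p s"
    using assms by (simp add: eventually_at_filter)
qed simp

text \<open>Take the largest power of \<open>Var 0\<close> dividing \<open>P\<close>. It exists
  because \<open>spec a\<close> maps such powers to powers of the line parameter dividing a nonzero
  univariate polynomial.\<close>

lemma split_Var_power:
  fixes P :: "real mpoly"
  assumes "spec a P \<noteq> 0"
  obtains p R where "P = Var 0 ^ p * R" "\<not> Var 0 dvd R"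
proof -
  interpret spec: comm_ring_hom "spec a" by (rule comm_ring_hom_spec)
  have bound: "p \<le> degree (spec a P)" if dvd: "Var 0 ^ p dvd P" for p
  proof -
    from dvd obtain R where "P = Var 0 ^ p * R" by (elim dvdE)
    then have "spec a P = [:0, 1:] ^ p * spec a R"
      by (simp add: spec.hom_mult spec.hom_power spec_Var_0)
    then have "[:0, 1:] ^ p dvd spec a P" by simp
    from dvd_imp_degree_le[OF this assms] show ?thesis by (simp add: degree_power_eq)
  qed
  then have "\<exists>p. Var 0 ^ p dvd P \<and> (\<forall>q. Var 0 ^ q dvd P \<longrightarrow> q \<le> p)"
    by (intro Nat.ex_has_greatest_nat[of _ 0]) auto
  then obtain p where p: "Var 0 ^ p dvd P" "\<not> Var 0 ^ Suc p dvd P"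
    by (metis not_less_eq_eq order_refl)
  from p(1) obtain R where R: "P = Var 0 ^ p * R" by (elim dvdE)
  moreover have "\<not> Var 0 dvd R"
    using p(2) by (auto simp: R mult_ac)
  ultimately show ?thesis using that by blast
qed

theorem theorem3p3:
  fixes F :: "real mpoly" and fRe fIm :: "real mpoly poly" and n d :: nat
  assumes "indets F \<subseteq> {..n}"
    and "is_form d F"
    and "meval F e0 = 1"
    and "re_im_parts F fRe fIm"
  shows "\<exists>(p::nat) (R::real mpoly).
      d \<le> p \<and> indets R \<subseteq> {..n} \<and>
      resultant fRe fIm = Var 0 ^ p * R \<and> \<not> Var 0 dvd R \<and>
      (hyperbolic F e0 \<longrightarrow>
         (\<forall>s a. 0 \<le> meval R (a(0 := s))) \<or> (\<forall>s a. meval R (a(0 := s)) \<le> 0)) \<and>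
      ((\<forall>s a. s \<noteq> 0 \<longrightarrow> meval R (a(0 := s)) \<noteq> 0) \<longrightarrow> hyperbolic F e0)"
proof -
  define \<rho> where "\<rho> = resultant fRe fIm"
  have "\<exists>r. cspec a F = (\<Prod>j<d. [:- r j, 1:])" for a
    by (rule cspec_linear_factors[OF assms(2,3)]) blast
  then obtain r where roots: "cspec a F = (\<Prod>j<d. [:- r a j, 1:])" for a by metis
  have roots_iff: "poly (cspec a F) z = 0 \<longleftrightarrow> (\<exists>j<d. z = r a j)" for a z
    by (auto simp: roots poly_prod)
  \<comment> \<open>The second factor in \<open>meval_resultant\<close>, as a polynomial in
    \<open>s\<close>. It is nonzero for every \<open>a\<close>, since each factor has leading
    coefficient -4.\<close>
  define \<epsilon> where "\<epsilon> a = (\<Prod>j<d. \<Prod>k<j. [:- ((r a j - r a k)^2), 0, -4:])" for a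
  have poly_\<epsilon>: "poly (\<epsilon> a) z = (\<Prod>j<d. \<Prod>k<j. - (4 * z ^ 2 + (r a j - r a k) ^ 2))" for a z
    by (simp add: \<epsilon>_def poly_prod algebra_simps power2_eq_square)
  have cspec_\<rho>: "cspec a \<rho> = [:0, 1:] ^ d * \<epsilon> a" for a
  proof (rule complex_poly_eqI)
    fix s :: real assume "s \<noteq> 0"
    from meval_resultant[OF assms(2-4) this roots]
    show "poly (cspec a \<rho>) (of_real s) = poly ([:0, 1:] ^ d * \<epsilon> a) (of_real s)"
      by (simp add: poly_spec \<rho>_def poly_\<epsilon>)
  qed
  have "spec a \<rho> \<noteq> 0" for a
  proof -
    have "[:0, 1:] ^ d * \<epsilon> a \<noteq> 0" by (simp add: \<epsilon>_def)
    then show ?thesis unfolding cspec_\<rho>[symmetric] by auto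
  qed
  then obtain p R where R: "\<rho> = Var 0 ^ p * R" and ndvd: "\<not> Var 0 dvd R"
    using split_Var_power by blast
  have cspec_R: "[:0, 1:] ^ p * cspec a R = [:0, 1:] ^ d * \<epsilon> a" for a
  proof -
    interpret spec: comm_ring_hom "spec a" by (rule comm_ring_hom_spec)
    interpret orp: map_poly_comm_ring_hom complex_of_real ..
    show ?thesis unfolding cspec_\<rho>[symmetric] R
      by (simp add: spec.hom_mult spec.hom_power spec_Var_0 orp.hom_mult orp.hom_power map_poly_pCons)
  qed
  \<comment> \<open>Both \<open>d \<le> p\<close> and the parity of \<open>p - d\<close> follow from
    this: if either failed, \<open>R\<close> would vanish wherever \<open>t_2 = 0\<close>.\<close>
  have not_all_0: "\<not> (\<forall>a. poly (cspec a R) 0 = 0)"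
  proof
    assume *: "\<forall>a. poly (cspec a R) 0 = 0"
    have "meval R (a(0 := 0)) = 0" for a
    proof -
      have "poly (cspec a R) (of_real 0) = of_real (meval R (a(0 := 0)))"
        unfolding of_real_hom.poly_map_poly poly_spec by (rule refl)
      with * show ?thesis by simp
    qed
    then show False using Var_dvd_if_vanishes ndvd by blast
  qed
  have "d \<le> p"
  proof (rule ccontr)
    assume "\<not> d \<le> p"
    then have "[:0, 1:] ^ d = ([:0, 1:] ^ p * ([:0, 1:] * [:0, 1:] ^ (d - p - 1)) :: complex poly)"
      by (simp flip: power_add power_Suc)
    then have "[:0, 1:] ^ p * cspec a R = [:0, 1:] ^ p * ([:0, 1:] * ([:0, 1:] ^ (d - p - 1) * \<epsilon> a))" for a
      unfolding cspec_R by (simp only: mult.assoc)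
    then have "cspec a R = [:0, 1:] * ([:0, 1:] ^ (d - p - 1) * \<epsilon> a)" for a
      by (rule mult_left_cancel[THEN iffD1, rotated]) simp
    with not_all_0 show False by simp
  qed
  \<comment> \<open>The excess power is positive exactly when \<open>\<epsilon> a\<close> vanishes
    at 0 for all \<open>a\<close>, that is, when every \<open>cspec a F\<close> has a repeated
    root.\<close>
  define q where "q = p - d"
  have "[:0, 1:] ^ p = ([:0, 1:] ^ d * [:0, 1:] ^ q :: complex poly)"
    using \<open>d \<le> p\<close> by (simp add: q_def flip: power_add)
  then have \<epsilon>: "\<epsilon> a = [:0, 1:] ^ q * cspec a R" for a
    using cspec_R[of a] by (simp add: mult.assoc)
  then have poly_R: "of_real (s ^ q * meval R (a(0 := s))) = poly (\<epsilon> a) (of_real s)" for s a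
    by (simp add: poly_spec)
  \<comment> \<open>Since \<open>\<epsilon> a\<close> is even, an odd \<open>q\<close> would make
    \<open>R\<close> odd in \<open>t_2\<close>. For even \<open>q\<close> the factor
    \<open>s ^ q\<close> is positive at \<open>s \<noteq> 0\<close>, so \<open>R\<close> and
    \<open>\<epsilon> a\<close> have the same sign there.\<close>
  have "even q"
  proof (rule ccontr)
    assume "odd q"
    have "cspec a R \<circ>\<^sub>p [:0, -1:] = - cspec a R" for a
    proof (rule complex_poly_eqI)
      fix s :: real assume "s \<noteq> 0"
      have "poly (\<epsilon> a) (of_real (- s)) = poly (\<epsilon> a) (of_real s)"
        by (simp add: poly_\<epsilon>)
      then have "(- s) ^ q * meval R (a(0 := - s)) = s ^ q * meval R (a(0 := s))"
        unfolding poly_R[symmetric] of_real_eq_iff .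
      with \<open>odd q\<close> have "s ^ q * meval R (a(0 := - s)) = s ^ q * - meval R (a(0 := s))"
        by simp
      with \<open>s \<noteq> 0\<close> have *: "meval R (a(0 := - s)) = - meval R (a(0 := s))"
        by (metis mult_left_cancel power_not_zero)
      have "poly (cspec a R) (of_real (- s)) = - poly (cspec a R) (of_real s)"
        unfolding of_real_hom.poly_map_poly poly_spec * by simp
      then show "poly (cspec a R \<circ>\<^sub>p [:0, -1:]) (of_real s) = poly (- cspec a R) (of_real s)"
        by (simp add: poly_pcompose)
    qed
    then have "poly (cspec a R \<circ>\<^sub>p [:0, -1:]) 0 = poly (- cspec a R) 0" for a by metis
    then have "poly (cspec a R) 0 = 0" for a by (simp add: poly_pcompose)
    with not_all_0 show False by blast
  qed
  have "(\<forall>s a. 0 \<le> meval R (a(0 := s))) \<or> (\<forall>s a. meval R (a(0 := s)) \<le> 0)" if hyp: "hyperbolic F e0"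
  proof -
    \<comment> \<open>The sign collected from the minus signs of the quadratic factors. It depends
      on \<open>d\<close> but not on \<open>a\<close>, so it is the common sign of all
      values.\<close>
    define c :: real where "c = (\<Prod>j<d. \<Prod>k<j. -1)"
    have "c * c = 1" by (simp add: c_def flip: prod.distrib)
    have "0 \<le> poly (smult c (spec a R)) s" if s: "s \<noteq> 0" for a s
    proof -
      have "r a j \<in> \<real>" if "j < d" for j
        using hyp roots_iff[of a "r a j"] that unfolding hyperbolic_e0_iff real_rooted_def by blast
      then have r: "r a j = of_real (Re (r a j))" if "j < d" for j
        using that by simp
      have "poly (\<epsilon> a) (of_real s) = of_real (c * (\<Prod>j<d. \<Prod>k<j. 4 * s ^ 2 + (Re (r a j) - Re (r a k)) ^ 2))"
        unfolding poly_\<epsilon> c_def prod.distrib[symmetric] of_real_prod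
      proof (intro prod.cong refl)
        fix j k assume "j \<in> {..<d}" "k \<in> {..<j}"
        then have "j < d" "k < d" by auto
        then show "- (4 * of_real s ^ 2 + (r a j - r a k) ^ 2) =
            complex_of_real (- 1 * (4 * s ^ 2 + (Re (r a j) - Re (r a k)) ^ 2))"
          by (subst (1 2) r) simp_all
      qed
      then have eq: "s ^ q * meval R (a(0 := s)) = c * (\<Prod>j<d. \<Prod>k<j. 4 * s ^ 2 + (Re (r a j) - Re (r a k)) ^ 2)"
        unfolding poly_R[symmetric] of_real_eq_iff .
      have "s ^ q * (c * meval R (a(0 := s))) = c * (s ^ q * meval R (a(0 := s)))"
        by simp
      also have "\<dots> = (\<Prod>j<d. \<Prod>k<j. 4 * s ^ 2 + (Re (r a j) - Re (r a k)) ^ 2)"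
        unfolding eq mult.assoc[symmetric] \<open>c * c = 1\<close> by simp
      also have "\<dots> \<ge> 0" by (intro prod_nonneg) simp
      finally show ?thesis
        using zero_less_power_eq[of s q] \<open>even q\<close> s by (simp add: poly_spec zero_le_mult_iff)
    qed
    then have "0 \<le> poly (smult c (spec a R)) s" for a s
      using poly_nonneg_at_0 by (cases "s = 0") blast+
    then have "0 \<le> c * meval R (a(0 := s))" for a s
      by (simp add: poly_spec)
    moreover have "c = 1 \<or> c = -1"
      using \<open>c * c = 1\<close> by (simp add: square_eq_1_iff)
    ultimately show ?thesis by force
  qed
  moreover have "hyperbolic F e0" if nz: "\<forall>s a. s \<noteq> 0 \<longrightarrow> meval R (a(0 := s)) \<noteq> 0"
  proof (rule ccontr)
    assume "\<not> hyperbolic F e0"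
    then obtain a z where z: "poly (cspec a F) z = 0" "z \<notin> \<real>"
      using assms(3) by (auto simp: hyperbolic_e0_iff real_rooted_def)
    then have "poly (cspec a F) (cnj z) = 0"
      by (simp add: real_poly_cnj_root_iff coeff_map_poly)
    with z(1) obtain j k where jk: "j < d" "k < d" "z = r a j" "cnj z = r a k"
      by (auto simp: roots_iff)
    have "Im z \<noteq> 0" using z(2) by (simp add: complex_is_Real_iff)
    then have "j \<noteq> k" using jk by (metis complex_cnj_cancel_iff Reals_cnj_iff z(2))
    have "(z - cnj z) ^ 2 = - 4 * complex_of_real (Im z) ^ 2"
      by (simp add: complex_diff_cnj power_mult_distrib)
    then have zero: "- (4 * complex_of_real (Im z) ^ 2 + (r a j - r a k) ^ 2) = 0"
      "- (4 * complex_of_real (Im z) ^ 2 + (r a k - r a j) ^ 2) = 0"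
      by (simp_all add: power2_commute[of "cnj z" z] flip: jk(3,4))
    \<comment> \<open>Only pairs with the smaller index second occur in \<open>\<epsilon> a\<close>.
      Which of \<open>j\<close> and \<open>k\<close> is larger is not known, so this is applied to
      both orders.\<close>
    have vanish: "poly (\<epsilon> a) (of_real (Im z)) = 0"
      if "l < m" "m < d" "- (4 * complex_of_real (Im z) ^ 2 + (r a m - r a l) ^ 2) = 0" for l m
      unfolding poly_\<epsilon>
    proof (rule prod_zero)
      show "\<exists>j\<in>{..<d}. (\<Prod>k<j. - (4 * complex_of_real (Im z) ^ 2 + (r a j - r a k) ^ 2)) = 0"
        by (rule bexI[of _ m], rule prod_zero, simp, rule bexI[of _ l]) (use that in simp_all)
    qed simp
    from \<open>j \<noteq> k\<close> have "k < j \<or> j < k" by auto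
    then have "poly (\<epsilon> a) (of_real (Im z)) = 0"
      using vanish[OF _ jk(1) zero(1)] vanish[OF _ jk(2) zero(2)] by blast
    then have "Im z ^ q * meval R (a(0 := Im z)) = 0"
      unfolding poly_R[symmetric] by simp
    with nz \<open>Im z \<noteq> 0\<close> show False by simp
  qed
  moreover have "indets R \<subseteq> {..n}"
  proof (rule indets_Var_power_mult)
    show "indets (Var 0 ^ p * R) \<subseteq> {..n}"
      unfolding R[symmetric] \<rho>_def
      by (intro indets_resultant indets_re_im_parts[OF assms(1,4)])
  qed
  ultimately show ?thesis
    using \<open>d \<le> p\<close> R ndvd unfolding \<rho>_def by blast
qed

end
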